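(* Let $f:\mathbb{R}^N\to\mathbb{R}$ be continuously differentiable and $L$-smooth with respect to $\|\cdot\|_2$ (possibly non-convex), let $x^*$ be a minimizer of $f$ on $\mathbb{R}^N$ (assumed to exist), let $\{1,\dots,N\}$ be partitioned into $n$ blocks $I_1,\dots,I_n$, and assume that for every $p\in\{1,\dots,n\}$ and $z\in\mathbb{R}^N$ the problem $\min_{x\in S_p(z)}f(x)$ has a solution. Let $x^k,y^k$ be generated by the AAM algorithm (defined in the context) from a starting point $x^0$. (a) After $k\ge 1$ steps of the algorithm, $$\min_{i=0,\dots,k}\|\nabla f(y^i)\|_2^2\le \frac{2nL\,(f(x^0)-f(x^* ))}{k}.$$ (b) If additionally $f$ is convex, then after $k\ge 1$ steps of the algorithm, $$f(x^k)-f(x^* )\le \frac{2nL\|x^0-x^*\|_2^2}{k^2}.$$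
   Context: $f$ is $L$-smooth if $\|\nabla f(x)-\nabla f(y)\|_2\le L\|x-y\|_2$ for all $x,y$. The index set $\{1,\dots,N\}$ of the standard basis $\{e_i\}$ is a disjoint union of blocks $I_1,\dots,I_n$; $S_p(x)=x+\mathrm{span}\{e_i: i\in I_p\}$; $\nabla_p f(x)$ is the subvector of $\nabla f(x)$ with indices in $I_p$. AAM algorithm (Accelerated Alternating Minimization): given $x^0$, set $A_0=0$, $v^0=x^0$. For $k=0,1,2,\dots$: 1. $\beta_k\in\arg\min_{\beta\in[0,1]} f(x^k+\beta(v^k-x^k))$ and $y^k=x^k+\beta_k(v^k-x^k)$. 2. $i_k\in\arg\max_{i\in\{1,\dots,n\}}\|\nabla_i f(y^k)\|_2^2$. 3. $x^{k+1}\in\arg\min_{x\in S_{i_k}(y^k)}f(x)$. 4. Find $a_{k+1}>0$ and $A_{k+1}=A_k+a_{k+1}$ such that $f(y^k)-\frac{a_{k+1}^2}{2A_{k+1}}\|\nabla f(y^k)\|_2^2=f(x^{k+1})$. 5. $v^{k+1}=v^k-a_{k+1}\nabla f(y^k)$. The algorithm is run as long as $\nabla f(y^k)\neq 0$. A choice of minimizer or maximizer is arbitrary when it is not unique. *)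

theory Defs
  imports "HOL-Analysis.Analysis"
begin

text \<open>
  The coordinates of \<open>real ^ 'N\<close> are indexed by the finite type \<open>'N\<close>, and a family
  \<open>I :: nat \<Rightarrow> 'N set\<close> splits them into the blocks \<open>I 1, \<dots>, I n\<close>.
  The gradient of \<open>f\<close> is a function \<open>g\<close> satisfying \<open>GDERIV f x :> g x\<close> for every \<open>x\<close>.
\<close>

definition is_block_partition :: "nat \<Rightarrow> (nat \<Rightarrow> 'N set) \<Rightarrow> bool" where
  "is_block_partition n I \<longleftrightarrow>
     disjoint_family_on I {1..n} \<and> (\<Union>p\<in>{1..n}. I p) = UNIV"

definition block_space :: "(nat \<Rightarrow> 'N::finite set) \<Rightarrow> nat \<Rightarrow> real ^ 'N \<Rightarrow> (real ^ 'N) set" where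
  "block_space I p z = (\<lambda>u. z + u) ` span ((\<lambda>i. axis i 1) ` I p)"

text \<open>
  The length of a subvector depends on the block, so it is kept as a family of entries indexed by
  \<open>J\<close>; its Euclidean norm is then the \<open>L2_set\<close> over \<open>J\<close>, just as \<open>norm\<close> on
  \<open>real ^ 'N\<close> is the \<open>L2_set\<close> over all coordinates.
\<close>

definition subvector :: "real ^ 'N::finite \<Rightarrow> 'N set \<Rightarrow> 'N \<Rightarrow> real" where
  "subvector w J = restrict (\<lambda>i. w $ i) J"

definition aam_line_search ::
  "(real ^ 'N::finite \<Rightarrow> real) \<Rightarrow> real ^ 'N \<Rightarrow> real ^ 'N \<Rightarrow> real \<Rightarrow> real ^ 'N \<Rightarrow> bool" where
  "aam_line_search f x v \<beta> y \<longleftrightarrow>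
     is_arg_min (\<lambda>b. f (x + b *\<^sub>R (v - x))) (\<lambda>b. b \<in> {0..1}) \<beta> \<and>
     y = x + \<beta> *\<^sub>R (v - x)"

text \<open>
  \<open>aam_steps f g n I x0 x v y \<beta> i a A k\<close>: the sequences \<open>x, v, y, \<beta>, i, a, A\<close> record \<open>k\<close>
  completed iterations (those numbered \<open>0, \<dots>, k - 1\<close>) started from \<open>x0\<close>. Only the entries
  \<open>y 0, \<dots>, y (k - 1)\<close> are constrained, as \<open>y k\<close> belongs to iteration \<open>k\<close>. Argmins and
  argmaxes are relations, so ties are broken arbitrarily.
\<close>

definition aam_steps ::
  "(real ^ 'N::finite \<Rightarrow> real) \<Rightarrow> (real ^ 'N \<Rightarrow> real ^ 'N) \<Rightarrow> nat \<Rightarrow> (nat \<Rightarrow> 'N set) \<Rightarrow> real ^ 'N \<Rightarrow>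
   (nat \<Rightarrow> real ^ 'N) \<Rightarrow> (nat \<Rightarrow> real ^ 'N) \<Rightarrow> (nat \<Rightarrow> real ^ 'N) \<Rightarrow>
   (nat \<Rightarrow> real) \<Rightarrow> (nat \<Rightarrow> nat) \<Rightarrow> (nat \<Rightarrow> real) \<Rightarrow> (nat \<Rightarrow> real) \<Rightarrow> nat \<Rightarrow> bool" where
  "aam_steps f g n I x0 x v y \<beta> i a A k \<longleftrightarrow>
     x 0 = x0 \<and> v 0 = x0 \<and> A 0 = 0 \<and>
     (\<forall>j<k.
        aam_line_search f (x j) (v j) (\<beta> j) (y j) \<and>
        g (y j) \<noteq> 0 \<and>
        is_arg_max (\<lambda>p. (L2_set (subvector (g (y j)) (I p)) (I p))\<^sup>2) (\<lambda>p. p \<in> {1..n}) (i j) \<and>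
        is_arg_min f (\<lambda>z. z \<in> block_space I (i j) (y j)) (x (Suc j)) \<and>
        a (Suc j) > 0 \<and>
        A (Suc j) = A j + a (Suc j) \<and>
        f (y j) - (a (Suc j))\<^sup>2 / (2 * A (Suc j)) * (norm (g (y j)))\<^sup>2 = f (x (Suc j)) \<and>
        v (Suc j) = v j - a (Suc j) *\<^sub>R g (y j))"

end

theory Submission
  imports Defs
begin

text \<open>
  Smoothness says that a move \<open>h\<close> from a point \<open>y\<close> changes \<open>f\<close> by at most
  \<open>g y \<bullet> h + L/2 * \<parallel>h\<parallel>\<^sup>2\<close> (\<open>lipschitz_gradient_upper_bound\<close>).  Exact minimization over a block
  does at least as well as the gradient step of length \<open>1/L\<close> along that block, and the greedily
  chosen block carries at least an \<open>n\<close>-th of \<open>\<parallel>g y\<parallel>\<^sup>2\<close>; hence every iteration satisfies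
  \<open>f x\<^sup>+ \<le> f y - \<parallel>g y\<parallel>\<^sup>2 / (2 n L)\<close> (\<open>greedy_block_decrease\<close>).  Both claims use this decrease
  and the fact that the line search never increases \<open>f\<close>.

  Without convexity, the decreases add up to at most \<open>f x0 - f xstar\<close>, so the smallest of the
  squared gradient norms is at most their average.

  With convexity, \<open>A (f x - f xstar) + \<parallel>v - xstar\<parallel>\<^sup>2 / 2\<close> never increases
  (\<open>potential_nonincreasing\<close>).  The equation that determines the step size makes the quadratic term
  produced by the move of \<open>v\<close> cancel exactly; what remains is controlled by the tangent inequality
  at \<open>y\<close>, and by \<open>g y \<bullet> (v - y) \<ge> 0\<close>, which is the optimality condition of the line search.
  The initial value of the potential bounds \<open>A k (f (x k) - f xstar)\<close>, and comparing the step size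
  equation with the decrease gives \<open>A\<^sup>+ \<le> n L (a\<^sup>+)\<^sup>2\<close>, which forces \<open>A k\<close> to grow like
  \<open>k\<^sup>2 / (4 n L)\<close> (\<open>quadratic_growth\<close>).
\<close>

section \<open>First-order inequalities\<close>

lemma GDERIV_along_line:
  assumes "\<And>z. GDERIV f z :> g z"
  shows "((\<lambda>t. f (y + t *\<^sub>R h)) has_real_derivative g (y + t *\<^sub>R h) \<bullet> h) (at t)"
proof -
  have "(f has_derivative (\<lambda>u. u \<bullet> g (y + t *\<^sub>R h))) (at (y + t *\<^sub>R h))"
    using assms unfolding gderiv_def by (simp add: inner_commute)
  moreover have "((\<lambda>t. y + t *\<^sub>R h) has_derivative (\<lambda>s. s *\<^sub>R h)) (at t)"
    by (auto intro!: derivative_eq_intros)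
  ultimately have "((\<lambda>t. f (y + t *\<^sub>R h)) has_derivative (\<lambda>s. (s *\<^sub>R h) \<bullet> g (y + t *\<^sub>R h))) (at t)"
    using has_derivative_compose by blast
  then show ?thesis
    unfolding has_field_derivative_def
    by (rule has_derivative_eq_rhs) (auto simp: inner_commute)
qed

lemma right_minimum_imp_deriv_nonneg:
  fixes \<phi> :: "real \<Rightarrow> real"
  assumes "(\<phi> has_real_derivative D) (at 0)"
    and "\<And>t. 0 \<le> t \<Longrightarrow> t \<le> 1 \<Longrightarrow> \<phi> 0 \<le> \<phi> t"
  shows "0 \<le> D"
proof (rule ccontr)
  assume "\<not> 0 \<le> D"
  then obtain d where "d > 0" and d: "\<And>h. 0 < h \<Longrightarrow> h < d \<Longrightarrow> \<phi> (0 + h) < \<phi> 0"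
    using DERIV_neg_dec_right[OF assms(1)] by force
  then have "\<phi> (min (d / 2) 1) < \<phi> 0"
    using d[of "min (d / 2) 1"] by simp
  moreover have "\<phi> 0 \<le> \<phi> (min (d / 2) 1)"
    using \<open>d > 0\<close> by (intro assms(2)) auto
  ultimately show False by simp
qed

text \<open>
  The chord from \<open>y\<close> to \<open>z\<close> minus \<open>f\<close> is smallest at the end \<open>y\<close> of the segment, so its slope
  there is nonnegative.
\<close>

lemma convex_on_above_tangent:
  fixes f :: "'a::real_inner \<Rightarrow> real"
  assumes gradient: "\<And>z. GDERIV f z :> g z" and "convex_on UNIV f"
  shows "f y + g y \<bullet> (z - y) \<le> f z"
proof -
  let ?\<phi> = "\<lambda>t. f y + t * (f z - f y) - f (y + t *\<^sub>R (z - y))"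
  have "(?\<phi> has_real_derivative (f z - f y) - g y \<bullet> (z - y)) (at 0)"
    using GDERIV_along_line[OF gradient, of y "z - y" 0]
    by (auto intro!: derivative_eq_intros)
  moreover have "?\<phi> 0 \<le> ?\<phi> t" if "0 \<le> t" "t \<le> 1" for t
  proof -
    have "f ((1 - t) *\<^sub>R y + t *\<^sub>R z) \<le> (1 - t) * f y + t * f z"
      using convex_onD[OF \<open>convex_on UNIV f\<close>] that by simp
    moreover have "(1 - t) *\<^sub>R y + t *\<^sub>R z = y + t *\<^sub>R (z - y)"
      by (simp add: algebra_simps)
    ultimately show ?thesis by (simp add: algebra_simps)
  qed
  ultimately have "0 \<le> (f z - f y) - g y \<bullet> (z - y)"
    by (rule right_minimum_imp_deriv_nonneg)
  then show ?thesis by simp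
qed

text \<open>
  Along the segment from \<open>y\<close> to \<open>y + h\<close>, the Lipschitz bound makes the difference between \<open>f\<close> and
  the quadratic model a nonincreasing function, and at \<open>y\<close> the difference is zero.
\<close>

lemma lipschitz_gradient_upper_bound:
  fixes f :: "'a::real_inner \<Rightarrow> real"
  assumes gradient: "\<And>z. GDERIV f z :> g z" and smooth: "L-lipschitz_on UNIV g"
  shows "f (y + h) \<le> f y + g y \<bullet> h + L / 2 * (norm h)\<^sup>2"
proof -
  let ?\<psi> = "\<lambda>t. f (y + t *\<^sub>R h) - t * (g y \<bullet> h) - L / 2 * t\<^sup>2 * (norm h)\<^sup>2"
  have "?\<psi> 1 \<le> ?\<psi> 0"
  proof (rule DERIV_nonpos_imp_nonincreasing[where f = ?\<psi>])
    fix t :: real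
    assume t: "0 \<le> t" "t \<le> 1"
    let ?D = "g (y + t *\<^sub>R h) \<bullet> h - g y \<bullet> h - L * t * (norm h)\<^sup>2"
    have "(?\<psi> has_real_derivative ?D) (at t)"
      using GDERIV_along_line[OF gradient, of y h t]
      by (auto intro!: derivative_eq_intros)
    moreover have "(g (y + t *\<^sub>R h) - g y) \<bullet> h \<le> norm (g (y + t *\<^sub>R h) - g y) * norm h"
      by (rule norm_cauchy_schwarz)
    moreover have "norm (g (y + t *\<^sub>R h) - g y) \<le> L * (t * norm h)"
      using lipschitz_onD[OF smooth, of "y + t *\<^sub>R h" y] t by (simp add: dist_norm)
    then have "norm (g (y + t *\<^sub>R h) - g y) * norm h \<le> L * t * (norm h)\<^sup>2"
      using mult_right_mono[of _ _ "norm h"] by (fastforce simp: power2_eq_square mult.assoc)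
    ultimately show "\<exists>D. (?\<psi> has_real_derivative D) (at t) \<and> D \<le> 0"
      by (intro exI[of _ ?D] conjI) (simp_all only: inner_diff_left)
  qed simp
  then show ?thesis by simp
qed

text \<open>
  If \<open>L = 0\<close>, then \<open>f\<close> is affine and decreases without bound along a nonzero negative gradient.
\<close>

lemma lipschitz_gradient_constant_pos:
  fixes f :: "'a::real_inner \<Rightarrow> real"
  assumes gradient: "\<And>z. GDERIV f z :> g z" and smooth: "L-lipschitz_on UNIV g"
    and lower: "\<And>z. m \<le> f z" and "g y \<noteq> 0"
  shows "0 < L"
proof (rule ccontr)
  assume "\<not> 0 < L"
  then have "L = 0"
    using lipschitz_on_nonneg[OF smooth] by simp
  define s where "s = (f y - m + 1) / (norm (g y))\<^sup>2"
  have "f (y + (- s) *\<^sub>R g y) \<le> f y - s * (norm (g y))\<^sup>2"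
    using lipschitz_gradient_upper_bound[OF gradient smooth, of y "(- s) *\<^sub>R g y"] \<open>L = 0\<close>
    by (simp add: power2_norm_eq_inner)
  also have "\<dots> = m - 1"
    using \<open>g y \<noteq> 0\<close> by (simp add: s_def)
  finally show False
    using lower[of "y + (- s) *\<^sub>R g y"] by simp
qed

section \<open>Decrease by a greedy block step\<close>

lemma sum_L2_set_subvector_blocks:
  fixes w :: "real ^ 'N::finite"
  assumes "is_block_partition n I"
  shows "(\<Sum>p\<in>{1..n}. (L2_set (subvector w (I p)) (I p))\<^sup>2) = (norm w)\<^sup>2"
proof -
  have "(\<Sum>p\<in>{1..n}. (L2_set (subvector w (I p)) (I p))\<^sup>2) = (\<Sum>p\<in>{1..n}. \<Sum>j\<in>I p. (w $ j)\<^sup>2)"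
    by (simp add: L2_set_def subvector_def sum_nonneg)
  also have "\<dots> = (\<Sum>j\<in>(\<Union>p\<in>{1..n}. I p). (w $ j)\<^sup>2)"
    using assms
    by (intro sum.UNION_disjoint[symmetric])
      (auto simp: is_block_partition_def disjoint_family_on_def)
  also have "\<dots> = (norm w)\<^sup>2"
    using assms by (simp add: is_block_partition_def norm_vec_def L2_set_def sum_nonneg)
  finally show ?thesis .
qed

lemma block_space_contains_block_step:
  fixes w z :: "real ^ 'N::finite"
  shows "z + c *\<^sub>R (\<chi> j. if j \<in> I p then w $ j else 0) \<in> block_space I p z"
proof -
  have "(\<chi> j. if j \<in> I p then w $ j else 0) = (\<Sum>j\<in>I p. (w $ j) *\<^sub>R axis j 1)"
    by (simp add: vec_eq_iff axis_def if_distrib if_distribR sum.If_cases cong: if_cong)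
  also have "\<dots> \<in> span ((\<lambda>j. axis j 1) ` I p)"
    by (intro span_sum span_scale span_base) auto
  finally show ?thesis
    unfolding block_space_def by (intro imageI span_scale)
qed

lemma block_minimizer_decrease:
  fixes f :: "real ^ 'N::finite \<Rightarrow> real"
  assumes gradient: "\<And>z. GDERIV f z :> g z" and smooth: "L-lipschitz_on UNIV g" and "0 < L"
    and min: "is_arg_min f (\<lambda>z. z \<in> block_space I p y) u"
  shows "f u \<le> f y - (L2_set (subvector (g y) (I p)) (I p))\<^sup>2 / (2 * L)"
proof -
  define w where "w = (\<chi> j. if j \<in> I p then g y $ j else 0)"
  let ?B = "(L2_set (subvector (g y) (I p)) (I p))\<^sup>2"
  have B: "?B = (\<Sum>j\<in>I p. (g y $ j)\<^sup>2)"
    by (simp add: L2_set_def subvector_def sum_nonneg)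
  have inner_w: "g y \<bullet> w = ?B" and norm_w: "(norm w)\<^sup>2 = ?B"
    unfolding B power2_norm_eq_inner inner_vec_def w_def
    by (auto simp: if_distrib if_distribR sum.If_cases power2_eq_square cong: if_cong)
  have "f u \<le> f (y + (- 1 / L) *\<^sub>R w)"
    using min block_space_contains_block_step[of y "- 1 / L" I p "g y"]
    by (force simp: is_arg_min_def w_def)
  also have "\<dots> \<le> f y + g y \<bullet> ((- 1 / L) *\<^sub>R w) + L / 2 * (norm ((- 1 / L) *\<^sub>R w))\<^sup>2"
    by (rule lipschitz_gradient_upper_bound[OF gradient smooth])
  also have "\<dots> = f y - ?B / (2 * L)"
    using \<open>0 < L\<close> inner_w norm_w
    by (simp add: power_mult_distrib power_divide field_simps power2_eq_square)
  finally show ?thesis .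
qed

text \<open>
  The largest of the \<open>n\<close> block contributions to \<open>\<parallel>g y\<parallel>\<^sup>2\<close> is at least their average; this is
  where the factor \<open>n\<close> in both rates comes from.
\<close>

lemma greedy_block_decrease:
  fixes f :: "real ^ 'N::finite \<Rightarrow> real"
  assumes gradient: "\<And>z. GDERIV f z :> g z" and smooth: "L-lipschitz_on UNIV g" and "0 < L"
    and blocks: "is_block_partition n I"
    and max: "is_arg_max (\<lambda>p. (L2_set (subvector (g y) (I p)) (I p))\<^sup>2) (\<lambda>p. p \<in> {1..n}) p"
    and min: "is_arg_min f (\<lambda>z. z \<in> block_space I p y) u"
  shows "(norm (g y))\<^sup>2 \<le> 2 * (real n * L) * (f y - f u)"
proof -
  let ?B = "\<lambda>p. (L2_set (subvector (g y) (I p)) (I p))\<^sup>2"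
  have "(norm (g y))\<^sup>2 = (\<Sum>q\<in>{1..n}. ?B q)"
    by (rule sum_L2_set_subvector_blocks[OF blocks, symmetric])
  also have "\<dots> \<le> real (card {1..n}) * ?B p"
    using max by (intro sum_bounded_above) (force simp: is_arg_max_def not_less)
  also have "\<dots> \<le> real n * (2 * L * (f y - f u))"
    using block_minimizer_decrease[OF gradient smooth \<open>0 < L\<close> min] \<open>0 < L\<close>
    by (intro mult_mono) (auto simp: field_simps)
  finally show ?thesis by (simp add: mult_ac)
qed

section \<open>The line search and the potential\<close>

lemma line_search_le:
  assumes "aam_line_search f x v \<beta> y"
  shows "f y \<le> f x"
proof -
  have "\<not> f (x + 0 *\<^sub>R (v - x)) < f y"
    using assms unfolding aam_line_search_def is_arg_min_def
    by (metis atLeastAtMost_iff order_refl zero_le_one)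
  then show ?thesis by simp
qed

text \<open>The segment from \<open>y\<close> to \<open>v\<close> is part of the searched one, so \<open>f\<close> is smallest on it at \<open>y\<close>.\<close>

lemma line_search_inner_nonneg:
  assumes gradient: "\<And>z. GDERIV f z :> g z" and search: "aam_line_search f x v \<beta> y"
  shows "0 \<le> g y \<bullet> (v - y)"
proof (rule right_minimum_imp_deriv_nonneg)
  show "((\<lambda>t. f (y + t *\<^sub>R (v - y))) has_real_derivative g y \<bullet> (v - y)) (at 0)"
    using GDERIV_along_line[OF gradient, of y "v - y" 0] by simp
next
  fix t :: real
  assume t: "0 \<le> t" "t \<le> 1"
  have \<beta>: "0 \<le> \<beta>" "\<beta> \<le> 1" and y: "y = x + \<beta> *\<^sub>R (v - x)"
    using search by (auto simp: aam_line_search_def is_arg_min_def)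
  let ?b = "\<beta> + t * (1 - \<beta>)"
  have "t * (1 - \<beta>) \<le> 1 * (1 - \<beta>)"
    using t \<beta> by (intro mult_right_mono) auto
  then have "?b \<in> {0..1}"
    using t \<beta> by auto
  then have "f y \<le> f (x + ?b *\<^sub>R (v - x))"
    using search unfolding aam_line_search_def is_arg_min_def by (meson not_less)
  also have "x + ?b *\<^sub>R (v - x) = y + t *\<^sub>R (v - y)"
    by (simp add: y algebra_simps)
  finally show "f (y + 0 *\<^sub>R (v - y)) \<le> f (y + t *\<^sub>R (v - y))" by simp
qed

text \<open>
  This is one iteration of the accelerated scheme, with \<open>z\<close> any point of comparison.  The step size
  equation trades the decrease from \<open>y\<close> to \<open>u\<close> for the term \<open>\<alpha>\<^sup>2 \<parallel>g y\<parallel>\<^sup>2 / 2\<close> that appears when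
  \<open>\<parallel>v - \<alpha> g y - z\<parallel>\<^sup>2 / 2\<close> is expanded.
\<close>

lemma potential_nonincreasing:
  fixes f :: "real ^ 'N::finite \<Rightarrow> real"
  assumes gradient: "\<And>z. GDERIV f z :> g z" and convex: "convex_on UNIV f"
    and search: "aam_line_search f x v \<beta> y"
    and "0 \<le> A" "0 < \<alpha>"
    and step: "f y - \<alpha>\<^sup>2 / (2 * (A + \<alpha>)) * (norm (g y))\<^sup>2 = f u"
  shows "(A + \<alpha>) * (f u - f z) + (norm (v - \<alpha> *\<^sub>R g y - z))\<^sup>2 / 2
       \<le> A * (f x - f z) + (norm (v - z))\<^sup>2 / 2"
proof -
  have "(norm (v - \<alpha> *\<^sub>R g y - z))\<^sup>2
      = (norm (v - z))\<^sup>2 - 2 * \<alpha> * (g y \<bullet> (v - z)) + \<alpha>\<^sup>2 * (norm (g y))\<^sup>2"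
    unfolding power2_norm_eq_inner
    by (simp add: inner_diff_left inner_diff_right inner_commute algebra_simps power2_eq_square)
  moreover have "(A + \<alpha>) * (f y - f u) = \<alpha>\<^sup>2 * (norm (g y))\<^sup>2 / 2"
    using \<open>0 \<le> A\<close> \<open>0 < \<alpha>\<close> by (simp add: step[symmetric] field_simps)
  ultimately have expand: "(A + \<alpha>) * (f u - f z) + (norm (v - \<alpha> *\<^sub>R g y - z))\<^sup>2 / 2
      = A * (f y - f z) + \<alpha> * (f y - f z - g y \<bullet> (v - z)) + (norm (v - z))\<^sup>2 / 2"
    by (simp add: algebra_simps)
  have "f y - f z \<le> g y \<bullet> (y - z)"
    using convex_on_above_tangent[OF gradient convex, of y z] by (simp add: inner_diff_right)
  also have "\<dots> \<le> g y \<bullet> (v - z)"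
    using line_search_inner_nonneg[OF gradient search] by (simp add: inner_diff_right)
  finally have "\<alpha> * (f y - f z - g y \<bullet> (v - z)) \<le> 0"
    using \<open>0 < \<alpha>\<close> by (simp add: mult_le_0_iff)
  moreover have "A * (f y - f z) \<le> A * (f x - f z)"
    using line_search_le[OF search] \<open>0 \<le> A\<close> by (intro mult_left_mono) auto
  ultimately show ?thesis
    using expand by linarith
qed

text \<open>
  In terms of \<open>s = \<surd>(q * A)\<close>, the hypotheses give \<open>s'\<^sup>2 - s\<^sup>2 = q * a' \<ge> s'\<close>, hence
  \<open>(s' - 1/2)\<^sup>2 \<ge> s\<^sup>2\<close>: the root grows by at least a half in every step.
\<close>

lemma quadratic_growth:
  fixes a A :: "nat \<Rightarrow> real"
  assumes "0 < q" "A 0 = 0"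
    and a_pos: "\<And>j. j < k \<Longrightarrow> 0 < a (Suc j)"
    and A_Suc: "\<And>j. j < k \<Longrightarrow> A (Suc j) = A j + a (Suc j)"
    and large: "\<And>j. j < k \<Longrightarrow> A (Suc j) \<le> q * (a (Suc j))\<^sup>2"
  shows "(real k)\<^sup>2 \<le> 4 * q * A k"
proof -
  have root: "0 \<le> A j \<and> real j / 2 \<le> sqrt (q * A j)" if "j \<le> k" for j
    using that
  proof (induction j)
    case 0
    then show ?case using \<open>A 0 = 0\<close> by simp
  next
    case (Suc j)
    then have "j < k" and A_j: "0 \<le> A j" and IH: "real j / 2 \<le> sqrt (q * A j)" by auto
    note a' = a_pos[OF \<open>j < k\<close>] and A' = A_Suc[OF \<open>j < k\<close>]
    define s s' where "s = sqrt (q * A j)" and "s' = sqrt (q * A (Suc j))"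
    have "0 < A (Suc j)" using a' A' A_j by simp
    then have "0 \<le> s" "0 < s'" and s: "s\<^sup>2 = q * A j" "s'\<^sup>2 = q * A (Suc j)"
      using A_j \<open>0 < q\<close> by (simp_all add: s_def s'_def)
    have "q * A (Suc j) \<le> q * (q * (a (Suc j))\<^sup>2)"
      using large[OF \<open>j < k\<close>] \<open>0 < q\<close> by simp
    then have "s'\<^sup>2 \<le> (q * a (Suc j))\<^sup>2"
      unfolding s power_mult_distrib by (simp add: power2_eq_square mult.assoc)
    moreover have "0 \<le> q * a (Suc j)"
      using a' \<open>0 < q\<close> by simp
    ultimately have "s' \<le> q * a (Suc j)"
      by (rule power2_le_imp_le)
    then have diff: "s' \<le> s'\<^sup>2 - s\<^sup>2"
      unfolding s A' by (simp add: distrib_left)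
    then have "s' * 1 \<le> s' * s'"
      using zero_le_power2[of s] unfolding power2_eq_square by linarith
    then have "1 \<le> s'"
      using \<open>0 < s'\<close> by simp
    have "s\<^sup>2 \<le> (s' - 1 / 2)\<^sup>2"
      using diff by (simp add: power2_diff power_divide)
    moreover have "0 \<le> s' - 1 / 2"
      using \<open>1 \<le> s'\<close> by simp
    ultimately have "s \<le> s' - 1 / 2"
      by (rule power2_le_imp_le)
    then show ?case
      using IH \<open>0 < A (Suc j)\<close> by (simp add: s_def s'_def)
  qed
  have "(real k / 2)\<^sup>2 \<le> (sqrt (q * A k))\<^sup>2"
    using root[of k] by (intro power_mono) auto
  then show ?thesis
    using root[of k] \<open>0 < q\<close> by (simp add: power_divide)
qed

section \<open>Convergence rates\<close>

theorem theorem1: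
  fixes f :: "real ^ 'N::finite \<Rightarrow> real"
    and g :: "real ^ 'N \<Rightarrow> real ^ 'N"
    and L :: real
    and n k :: nat
    and I :: "nat \<Rightarrow> 'N set"
    and x0 xstar :: "real ^ 'N"
    and x v y :: "nat \<Rightarrow> real ^ 'N"
    and \<beta> a A :: "nat \<Rightarrow> real"
    and i :: "nat \<Rightarrow> nat"
  assumes gradient: "\<And>z. GDERIV f z :> g z"
    and continuous_gradient: "continuous_on UNIV g"
    and smooth: "L-lipschitz_on UNIV g"
    and minimizer: "is_arg_min f (\<lambda>z. z \<in> UNIV) xstar"
    and blocks: "is_block_partition n I"
    and block_minimizers:
      "\<And>p z. p \<in> {1..n} \<Longrightarrow> \<exists>u. is_arg_min f (\<lambda>u. u \<in> block_space I p z) u"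
    and run: "aam_steps f g n I x0 x v y \<beta> i a A k"
    and k: "k \<ge> 1"
  shows "(aam_line_search f (x k) (v k) (\<beta> k) (y k) \<longrightarrow>
            (MIN j\<in>{0..k}. (norm (g (y j)))\<^sup>2) \<le> 2 * real n * L * (f x0 - f xstar) / real k) \<and>
         (convex_on UNIV f \<longrightarrow>
            f (x k) - f xstar \<le> 2 * real n * L * (norm (x0 - xstar))\<^sup>2 / (real k)\<^sup>2)"
proof -
  define q where "q = real n * L"
  have lower: "f xstar \<le> f z" for z
    using minimizer by (auto simp: is_arg_min_def not_less)
  have x_0: "x 0 = x0" and v_0: "v 0 = x0" and A_0: "A 0 = 0"
    using run by (auto simp: aam_steps_def)
  have search: "aam_line_search f (x j) (v j) (\<beta> j) (y j)"
    and g_nonzero: "g (y j) \<noteq> 0"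
    and greedy: "is_arg_max (\<lambda>p. (L2_set (subvector (g (y j)) (I p)) (I p))\<^sup>2) (\<lambda>p. p \<in> {1..n}) (i j)"
    and block_min: "is_arg_min f (\<lambda>z. z \<in> block_space I (i j) (y j)) (x (Suc j))"
    and a_pos: "0 < a (Suc j)"
    and A_Suc: "A (Suc j) = A j + a (Suc j)"
    and step: "f (y j) - (a (Suc j))\<^sup>2 / (2 * A (Suc j)) * (norm (g (y j)))\<^sup>2 = f (x (Suc j))"
    and v_Suc: "v (Suc j) = v j - a (Suc j) *\<^sub>R g (y j)"
    if "j < k" for j
    using run that unfolding aam_steps_def by auto
  have "0 < L"
    using lipschitz_gradient_constant_pos[OF gradient smooth lower g_nonzero[of 0]] k by simp
  moreover have "0 < n"
    using greedy[of 0] k by (auto simp: is_arg_max_def)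
  ultimately have "0 < q"
    by (simp add: q_def)
  have decrease: "(norm (g (y j)))\<^sup>2 \<le> 2 * q * (f (y j) - f (x (Suc j)))" if "j < k" for j
    unfolding q_def
    by (rule greedy_block_decrease[OF gradient smooth \<open>0 < L\<close> blocks greedy block_min]) fact+
  have A_nonneg: "0 \<le> A j" if "j \<le> k" for j
    using that
  proof (induction j)
    case (Suc j)
    then show ?case using A_Suc[of j] a_pos[of j] by simp
  qed (simp add: A_0)

  have rate_gradient: "(MIN j\<in>{0..k}. (norm (g (y j)))\<^sup>2) \<le> 2 * q * (f x0 - f xstar) / real k"
  proof -
    let ?m = "MIN j\<in>{0..k}. (norm (g (y j)))\<^sup>2"
    have "real k * ?m = (\<Sum>j<k. ?m)"
      by simp
    also have "\<dots> \<le> (\<Sum>j<k. 2 * q * (f (x j) - f (x (Suc j))))"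
    proof (rule sum_mono)
      fix j
      assume "j \<in> {..<k}"
      then have "j < k" by simp
      then have "?m \<le> (norm (g (y j)))\<^sup>2"
        by (intro Min_le) auto
      also have "\<dots> \<le> 2 * q * (f (y j) - f (x (Suc j)))"
        by (rule decrease) fact
      also have "\<dots> \<le> 2 * q * (f (x j) - f (x (Suc j)))"
        using line_search_le[OF search[OF \<open>j < k\<close>]] \<open>0 < q\<close> by simp
      finally show "?m \<le> 2 * q * (f (x j) - f (x (Suc j)))" .
    qed
    also have "\<dots> = 2 * q * (f x0 - f (x k))"
      using sum_lessThan_telescope'[of "\<lambda>j. f (x j)" k]
      unfolding sum_distrib_left[symmetric] by (simp only: x_0)
    also have "\<dots> \<le> 2 * q * (f x0 - f xstar)"
      using lower[of "x k"] \<open>0 < q\<close> by simp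
    finally show ?thesis
      using k by (simp add: field_simps)
  qed

  have rate_convex: "f (x k) - f xstar \<le> 2 * q * (norm (x0 - xstar))\<^sup>2 / (real k)\<^sup>2"
    if "convex_on UNIV f"
  proof -
    let ?\<Phi> = "\<lambda>j. A j * (f (x j) - f xstar) + (norm (v j - xstar))\<^sup>2 / 2"
    have "?\<Phi> j \<le> ?\<Phi> 0" if "j \<le> k" for j
      using that
    proof (induction j)
      case (Suc j)
      then have "j < k" by simp
      have "?\<Phi> (Suc j) \<le> ?\<Phi> j"
        using potential_nonincreasing[OF gradient \<open>convex_on UNIV f\<close> search[OF \<open>j < k\<close>]
            A_nonneg[of j] a_pos[OF \<open>j < k\<close>], of "x (Suc j)" xstar]
          step[of j] v_Suc[of j] A_Suc[of j] \<open>j < k\<close>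
        by simp
      then show ?case using Suc by simp
    qed simp
    from this[of k] have "A k * (f (x k) - f xstar) \<le> (norm (x0 - xstar))\<^sup>2 / 2"
      using zero_le_power2[of "norm (v k - xstar)"] unfolding A_0 v_0 by linarith
    have "(real k)\<^sup>2 \<le> 4 * q * A k"
    proof (rule quadratic_growth[of q A k a, OF \<open>0 < q\<close> A_0 a_pos A_Suc])
      fix j
      assume "j < k"
      have "0 < A (Suc j)"
        using A_Suc[OF \<open>j < k\<close>] a_pos[OF \<open>j < k\<close>] A_nonneg[of j] \<open>j < k\<close> by simp
      \<comment> \<open>The step size equation expresses the decrease as a multiple of \<open>?G\<close>, which then cancels.\<close>
      let ?G = "(norm (g (y j)))\<^sup>2"
      have "?G \<le> 2 * q * ((a (Suc j))\<^sup>2 / (2 * A (Suc j)) * ?G)"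
        using decrease[OF \<open>j < k\<close>] by (simp add: step[OF \<open>j < k\<close>, symmetric])
      then have "A (Suc j) * ?G \<le> q * (a (Suc j))\<^sup>2 * ?G"
        using \<open>0 < A (Suc j)\<close> by (simp add: field_simps)
      then show "A (Suc j) \<le> q * (a (Suc j))\<^sup>2"
        using g_nonzero[OF \<open>j < k\<close>] by simp
    qed
    then have "(f (x k) - f xstar) * (real k)\<^sup>2 \<le> (f (x k) - f xstar) * (4 * q * A k)"
      using lower[of "x k"] by (intro mult_left_mono) auto
    also have "\<dots> = 4 * q * (A k * (f (x k) - f xstar))"
      by simp
    also have "\<dots> \<le> 4 * q * ((norm (x0 - xstar))\<^sup>2 / 2)"
      using \<open>0 < q\<close> \<open>A k * (f (x k) - f xstar) \<le> (norm (x0 - xstar))\<^sup>2 / 2\<close>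
      by (intro mult_left_mono) auto
    finally show ?thesis
      using k by (simp add: field_simps)
  qed

  show ?thesis
    using rate_gradient rate_convex by (simp add: q_def mult.assoc)
qed

end
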